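(* Let $0<k<n$ be integers. If $\varepsilon:\operatorname{Gr}(k,\mathbb{R}^n)\to\mathsf{S}^2(\mathbb{R}^n)$ is an $\operatorname{SO}_n(\mathbb{R})$-equivariant embedding, then there exist distinct $a,b\in\mathbb{R}$ such that the image of $\varepsilon$ equals $$\operatorname{Gr}_{a,b}(k,n) := \bigl\{ X\in\mathsf{S}^2(\mathbb{R}^n) : (X-aI_n)(X-bI_n)=0,\ \operatorname{tr}(X)=ak+b(n-k)\bigr\} = \Bigl\{ Q\begin{bmatrix} aI_k & 0\\ 0 & bI_{n-k}\end{bmatrix}Q^{\mathsf T} : Q\in\operatorname{SO}_n(\mathbb{R})\Bigr\}.$$ (The equality of the two sets displayed is part of the assertion.)
   Context: $\mathsf{S}^2(\mathbb{R}^n)$ is the space of real symmetric $n\times n$ matrices, on which $Q\in\operatorname{SO}_n(\mathbb{R})$ acts by $Q\cdot X := QXQ^{\mathsf T}$. $\operatorname{Gr}(k,\mathbb{R}^n)$ is the (smooth) Grassmann manifold of $k$-dimensional linear subspaces of $\mathbb{R}^n$, on which $Q$ acts by $Q\cdot\mathbb{W}:=\{Qw: w\in\mathbb{W}\}$. An embedding $\varepsilon$ is $\operatorname{SO}_n(\mathbb{R})$-equivariant if $\varepsilon(Q\cdot x)=Q\cdot\varepsilon(x)$ for all $Q$ and $x$. *)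

theory Defs
  imports "HOL-Analysis.Analysis"
begin

definition symmetric_matrices :: "(real^'n^'n) set" where
  "symmetric_matrices = {X. transpose X = X}"

definition Gr :: "nat \<Rightarrow> (real^'n) set set" where
  "Gr k = {W. subspace W \<and> dim W = k}"

text \<open>
  The standard atlas of the Grassmannian is indexed by its points. The chart at \<open>W\<close> has the model
  space \<open>Hom(W, W\<^sup>\<bottom>)\<close>, realized as the linear subspace \<open>chart_space W\<close> of those matrices that vanish
  on the orthogonal complement of \<open>W\<close> and take values in it; its (inverse) chart map sends \<open>L\<close> to
  the graph of \<open>L\<close> over \<open>W\<close>. Its image is the set of all \<open>k\<close>-dimensional subspaces that meet
  the orthogonal complement of \<open>W\<close> only in \<open>0\<close>.
\<close>

definition chart_space :: "(real^'n) set \<Rightarrow> (real^'n^'n) set" where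
  "chart_space W = {L. (\<forall>v. L *v v \<in> W\<^sup>\<bottom>) \<and> (\<forall>v\<in>W\<^sup>\<bottom>. L *v v = 0)}"

definition chart_graph :: "(real^'n) set \<Rightarrow> real^'n^'n \<Rightarrow> (real^'n) set" where
  "chart_graph W L = (\<lambda>w. w + L *v w) ` W"

text \<open>The manifold topology: a set is open iff it is open in every chart.\<close>

definition Gr_topology :: "nat \<Rightarrow> (real^'n) set topology" where
  "Gr_topology k = topology (\<lambda>U. U \<subseteq> Gr k \<and>
     (\<forall>W\<in>Gr k. openin (top_of_set (chart_space W)) {L \<in> chart_space W. chart_graph W L \<in> U}))"

lemma chart_graph_in_Gr:
  fixes W :: "(real^'n) set"
  assumes W: "W \<in> Gr k" and L: "L \<in> chart_space W"
  shows "chart_graph W L \<in> Gr k"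
proof -
  let ?f = "\<lambda>w::real^'n. w + L *v w"
  have lin: "linear ?f"
    by (intro linear_compose_add linear_id[unfolded id_def] matrix_vector_mul_linear)
  have sW: "subspace W" and dW: "dim W = k"
    using W by (auto simp: Gr_def)
  have "w = 0" if w: "w \<in> W" "?f w = 0" for w
  proof -
    have "L *v w \<in> W\<^sup>\<bottom>"
      using L by (simp add: chart_space_def)
    hence "w \<bullet> (L *v w) = 0"
      using w(1) by (simp add: orthogonal_comp_def orthogonal_def)
    moreover have "L *v w = - w"
      using w(2) by (simp add: eq_neg_iff_add_eq_0 add.commute)
    ultimately show ?thesis
      by simp
  qed
  hence "inj_on ?f (span W)"
    using sW by (simp add: linear_injective_on_subspace_0[OF lin] span_eq_iff[THEN iffD2])
  hence "dim (?f ` W) = k"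
    using dim_image_eq[OF lin] dW by blast
  moreover have "subspace (?f ` W)"
    by (rule linear_subspace_image[OF lin sW])
  ultimately show ?thesis
    by (simp add: Gr_def chart_graph_def)
qed

lemma openin_Gr_topology:
  fixes U :: "(real^'n) set set"
  shows "openin (Gr_topology k) U \<longleftrightarrow> U \<subseteq> Gr k \<and>
    (\<forall>W\<in>Gr k. openin (top_of_set (chart_space W)) {L \<in> chart_space W. chart_graph W L \<in> U})"
proof -
  let ?P = "\<lambda>W U. {L \<in> chart_space W. chart_graph W L \<in> (U :: (real^'n) set set)}"
  have i: "?P W (S \<inter> T) = ?P W S \<inter> ?P W T" for W S T
    by auto
  have u: "?P W (\<Union>K) = \<Union>(?P W ` K)" for W K
    by auto
  have "istopology (\<lambda>U :: (real^'n) set set. U \<subseteq> Gr k \<and>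
      (\<forall>W\<in>Gr k. openin (top_of_set (chart_space W)) (?P W U)))"
    unfolding istopology_def i u by (blast intro: openin_Int openin_Union)
  thus ?thesis
    by (simp add: Gr_topology_def topology_inverse')
qed

lemma topspace_Gr_topology: "topspace (Gr_topology k) = (Gr k :: (real^'n) set set)"
proof (rule antisym)
  show "topspace (Gr_topology k) \<subseteq> (Gr k :: (real^'n) set set)"
    using openin_Gr_topology openin_topspace by blast
  have "{L \<in> chart_space W. chart_graph W L \<in> Gr k} = chart_space W"
    if "W \<in> Gr k" for W :: "(real^'n) set"
    using that chart_graph_in_Gr by blast
  hence "openin (Gr_topology k) (Gr k :: (real^'n) set set)"
    by (simp add: openin_Gr_topology)
  thus "(Gr k :: (real^'n) set set) \<subseteq> topspace (Gr_topology k)"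
    by (rule openin_subset)
qed

text \<open>\<open>r\<close>-fold continuous differentiability, by recursion on the directional derivatives.\<close>

primrec Ck :: "nat \<Rightarrow> ('a::euclidean_space \<Rightarrow> 'b::euclidean_space) \<Rightarrow> bool" where
  "Ck 0 f \<longleftrightarrow> continuous_on UNIV f"
| "Ck (Suc r) f \<longleftrightarrow>
     (\<exists>f'. (\<forall>x. (f has_derivative f' x) (at x)) \<and> (\<forall>v. Ck r (\<lambda>x. f' x v)))"

text \<open>
  A map on a linear subspace \<open>T\<close> of a Euclidean space is smooth iff it is the restriction of a
  smooth map on the whole space (compose with the orthogonal projection onto \<open>T\<close>).
\<close>

definition smooth_on_subspace ::
    "'a::euclidean_space set \<Rightarrow> ('a \<Rightarrow> 'b::euclidean_space) \<Rightarrow> bool" where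
  "smooth_on_subspace T f \<longleftrightarrow> (\<exists>F. (\<forall>r. Ck r F) \<and> (\<forall>x\<in>T. F x = f x))"

text \<open>
  A derivative within a linear subspace \<open>T\<close> is uniquely determined on \<open>T\<close>, so that the existential
  quantifier in the immersion condition says that the differential of the chart representation is
  injective.
\<close>

definition smooth_embedding_Gr ::
    "nat \<Rightarrow> ((real^'n) set \<Rightarrow> 'b::euclidean_space) \<Rightarrow> bool" where
  "smooth_embedding_Gr k \<epsilon> \<longleftrightarrow>
     (\<forall>W\<in>Gr k. smooth_on_subspace (chart_space W) (\<lambda>L. \<epsilon> (chart_graph W L))) \<and>
     (\<forall>W\<in>Gr k. \<forall>L\<in>chart_space W. \<exists>D.
        ((\<lambda>L. \<epsilon> (chart_graph W L)) has_derivative D) (at L within chart_space W) \<and>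
        inj_on D (chart_space W)) \<and>
     embedding_map (Gr_topology k) euclidean \<epsilon>"

definition SO_equivariant_Gr :: "nat \<Rightarrow> ((real^'n) set \<Rightarrow> real^'n^'n) \<Rightarrow> bool" where
  "SO_equivariant_Gr k \<epsilon> \<longleftrightarrow>
     (\<forall>Q. rotation_matrix Q \<longrightarrow>
        (\<forall>W\<in>Gr k. \<epsilon> ((\<lambda>w. Q *v w) ` W) = Q ** \<epsilon> W ** transpose Q))"

text \<open>Note that \<open>mat a\<close> is the scalar matrix \<open>a I\<^sub>n\<close>.\<close>

definition Gr_ab :: "real \<Rightarrow> real \<Rightarrow> nat \<Rightarrow> (real^'n^'n) set" where
  "Gr_ab a b k = {X \<in> symmetric_matrices.
     (X - mat a) ** (X - mat b) = 0 \<and> trace X = a * real k + b * real (CARD('n) - k)}"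

text \<open>
  The block diagonal matrix with blocks \<open>a I\<^sub>k\<close> and \<open>b I\<^sub>n\<^sub>-\<^sub>k\<close>; the coordinates are numbered according
  to the linear order of the index type.
\<close>

definition block_diag :: "real \<Rightarrow> real \<Rightarrow> nat \<Rightarrow> real^('n::{finite,linorder})^('n::{finite,linorder})" where
  "block_diag a b k =
     (\<chi> i j. if i = j then (if card {l. l < i} < k then a else b) else 0)"

end

theory Submission
  imports Defs
begin

text \<open>
  The rotation group acts transitively on the \<open>k\<close>-dimensional subspaces, so the image of an
  equivariant map \<open>\<epsilon>\<close> is the orbit of the single symmetric matrix \<open>X = \<epsilon> E\<close>, where \<open>E\<close> is
  spanned by the first \<open>k\<close> coordinate vectors. On the other side, for \<open>a \<noteq> b\<close> the substitution
  \<open>X = b I + (a - b) P\<close> identifies \<open>Gr_ab a b k\<close> with the orthogonal projections \<open>P\<close> of trace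
  \<open>k\<close>, that is, with the projections onto the \<open>k\<close>-dimensional subspaces; transitivity once more
  shows that \<open>Gr_ab a b k\<close> is the orbit of \<open>block_diag a b k\<close> (\<open>Gr_ab_eq_orbit\<close>). Two orbits that
  share a point are equal, so it remains to find \<open>a \<noteq> b\<close> with \<open>X \<in> Gr_ab a b k\<close>.

  For \<open>n \<ge> 3\<close> this is a matter of symmetry: \<open>X\<close> is fixed by every rotation that preserves \<open>E\<close>. The
  rotations among the signed permutation matrices are enough to force \<open>X\<close> to be scalar on \<open>E\<close> and
  on its orthogonal complement and to have no other entries
  (\<open>block_scalar_if_stabilizer_invariant\<close>). For \<open>n = 2\<close> the stabilizer is \<open>{I, -I}\<close> and gives no
  information, but there every symmetric matrix satisfies a quadratic equation with real roots
  \<open>a\<close> and \<open>b\<close> whose sum is the trace (\<open>symmetric_2x2_in_Gr_ab\<close>).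

  In both cases \<open>a = b\<close> would make \<open>X\<close> a scalar matrix and hence \<open>\<epsilon>\<close> constant, which
  contradicts injectivity because \<open>0 < k < n\<close> provides at least two subspaces.
\<close>

section \<open>Signed permutation matrices\<close>

text \<open>
  This is the linear map \<open>x \<mapsto> (s i * x (\<pi> i))\<^sub>i\<close>. Conjugation by it permutes the entries of a matrix
  up to sign, which makes these matrices convenient probes for the consequences of equivariance.
\<close>

definition signed_perm :: "('n \<Rightarrow> real) \<Rightarrow> ('n \<Rightarrow> 'n) \<Rightarrow> real^'n^'n" where
  "signed_perm s \<pi> = (\<chi> i j. if j = \<pi> i then s i else 0)"

lemma signed_perm_mult_vector: "(signed_perm s \<pi> *v x) $ i = s i * x $ \<pi> i"
  by (simp add: signed_perm_def matrix_vector_mult_def if_distrib[of "\<lambda>x. x * _"] cong: if_cong)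

lemma signed_perm_conj:
  "(signed_perm s \<pi> ** X ** transpose (signed_perm s \<pi>)) $ i $ j = s i * s j * X $ \<pi> i $ \<pi> j"
  by (simp add: signed_perm_def matrix_matrix_mult_def transpose_def if_distrib[of "\<lambda>x. x * _"]
      if_distrib[of "\<lambda>x. _ * x"] cong: if_cong)

lemma orthogonal_signed_perm:
  assumes "inj \<pi>" and "\<And>i. s i * s i = 1"
  shows "orthogonal_matrix (signed_perm s \<pi>)"
proof -
  have "signed_perm s \<pi> ** mat 1 ** transpose (signed_perm s \<pi>) = mat 1"
    using assms unfolding vec_eq_iff signed_perm_conj by (auto simp: mat_def inj_eq)
  thus ?thesis
    by (simp add: orthogonal_matrix_def matrix_left_right_inverse)
qed

lemma det_signed_perm_id: "det (signed_perm s id) = prod s UNIV"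
  by (subst det_diagonal) (auto simp: signed_perm_def)

text \<open>
  Flipping the sign of a single coordinate reverses the sign of the determinant, so a
  permutation matrix of determinant \<open>-1\<close> can be corrected to a rotation.
\<close>

lemma exists_rotation_signed_perm:
  fixes \<pi> :: "'n::finite \<Rightarrow> 'n"
  assumes "inj \<pi>"
  obtains s where "\<forall>i. s i * s i = 1" "rotation_matrix (signed_perm s \<pi>)"
proof -
  let ?A = "signed_perm (\<lambda>_. 1) \<pi>"
  have A: "orthogonal_matrix ?A"
    by (rule orthogonal_signed_perm) (use assms in auto)
  show thesis
  proof (cases "det ?A = 1")
    case True
    have "rotation_matrix ?A" using A True by (simp add: rotation_matrix_def)
    thus thesis by (intro that[of "\<lambda>_. 1"]) simp_all
  next
    case False
    with det_orthogonal_matrix[OF A] have "det ?A = -1" by blast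
    moreover fix i0 :: 'n
    define s :: "'n \<Rightarrow> real" where "s = (\<lambda>i. if i = i0 then -1 else 1)"
    have "signed_perm s \<pi> = signed_perm s id ** ?A"
      by (simp add: vec_eq_iff signed_perm_def matrix_matrix_mult_def if_distrib[of "\<lambda>x. x * _"] cong: if_cong)
    ultimately have "det (signed_perm s \<pi>) = 1"
      by (simp add: det_mul det_signed_perm_id s_def)
    moreover have s: "s i * s i = 1" for i by (simp add: s_def)
    have "orthogonal_matrix (signed_perm s \<pi>)"
      by (rule orthogonal_signed_perm[OF assms s])
    ultimately have "rotation_matrix (signed_perm s \<pi>)"
      by (simp only: rotation_matrix_def)
    with s show thesis by (intro that[of s] allI)
  qed
qed

section \<open>Orthogonal projections and transitivity on subspaces\<close>

definition coord_subspace :: "'n set \<Rightarrow> (real^'n) set" where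
  "coord_subspace I = {x. \<forall>i. i \<notin> I \<longrightarrow> x $ i = 0}"

definition coord_proj :: "'n set \<Rightarrow> real^'n^'n" where
  "coord_proj I = (\<chi> i j. if i = j then if i \<in> I then 1 else 0 else 0)"

definition orth_proj_onto :: "real^'n^'n \<Rightarrow> (real^'n) set \<Rightarrow> bool" where
  "orth_proj_onto P W \<longleftrightarrow> transpose P = P \<and> P ** P = P \<and> range ((*v) P) = W"

lemma subspace_coord_subspace: "subspace (coord_subspace I)"
  by (auto simp: subspace_def coord_subspace_def)

lemma dim_coord_subspace: "dim (coord_subspace I :: (real^'n) set) = card I"
  unfolding coord_subspace_def dim_vec_eq[symmetric] by (rule dim_substandard_cart)

lemma coord_subspace_in_Gr: "coord_subspace I \<in> Gr (card I)"
  by (simp add: Gr_def subspace_coord_subspace dim_coord_subspace)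

lemma orth_proj_onto_coord: "orth_proj_onto (coord_proj I) (coord_subspace I :: (real^'n) set)"
proof -
  have v: "(coord_proj I *v x) $ i = (if i \<in> I then x $ i else 0)" for x :: "real^'n" and i
    by (simp add: coord_proj_def matrix_vector_mult_def if_distrib[of "\<lambda>x. x * _"] cong: if_cong)
  have fixed: "x \<in> coord_subspace I \<Longrightarrow> coord_proj I *v x = x" for x :: "real^'n"
    by (auto simp: vec_eq_iff v coord_subspace_def)
  have mem: "coord_proj I *v x \<in> coord_subspace I" for x :: "real^'n"
    by (auto simp: v coord_subspace_def)
  have "coord_proj I ** coord_proj I = (coord_proj I :: real^'n^'n)"
    by (simp add: matrix_eq fixed mem flip: matrix_vector_mul_assoc)
  moreover have "range ((*v) (coord_proj I)) = (coord_subspace I :: (real^'n) set)"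
  proof (intro equalityI subsetI)
    fix x :: "real^'n"
    assume "x \<in> coord_subspace I"
    hence "x = coord_proj I *v x" by (simp add: fixed)
    thus "x \<in> range ((*v) (coord_proj I))" by blast
  qed (use mem in blast)
  ultimately show ?thesis
    by (auto simp: orth_proj_onto_def coord_proj_def transpose_def vec_eq_iff)
qed

text \<open>If \<open>P\<close> and \<open>R\<close> have the same range, then \<open>PR = R\<close> and \<open>RP = P\<close>; transposing the first
  identity turns it into \<open>RP = R\<close>.\<close>

lemma orth_proj_onto_unique:
  assumes P: "orth_proj_onto P W" and R: "orth_proj_onto R W"
  shows "P = R"
proof -
  have absorb: "A ** B = B" if "orth_proj_onto A W" "orth_proj_onto B W" for A B
  proof -
    have "A *v (B *v x) = B *v x" for x
    proof -
      have "range ((*v) A) = range ((*v) B)" and AA: "A ** A = A"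
        using that by (simp_all only: orth_proj_onto_def)
      then obtain y where y: "B *v x = A *v y" by blast
      show ?thesis
        unfolding y matrix_vector_mul_assoc AA ..
    qed
    thus ?thesis by (simp add: matrix_eq matrix_vector_mul_assoc)
  qed
  have "R = transpose (P ** R)" using absorb[OF P R] R by (simp only: orth_proj_onto_def)
  also have "\<dots> = R ** P" using P R by (simp only: orth_proj_onto_def matrix_transpose_mul)
  also have "\<dots> = P" by (rule absorb[OF R P])
  finally show ?thesis by simp
qed

lemma conj_mult:
  fixes Q :: "real^'n^'n"
  assumes "orthogonal_matrix Q"
  shows "(Q ** A ** transpose Q) ** (Q ** B ** transpose Q) = Q ** (A ** B) ** transpose Q"
proof -
  have "transpose Q ** (Q ** Y) = Y" for Y :: "real^'n^'n"
    using assms by (simp add: orthogonal_matrix_def matrix_mul_assoc)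
  thus ?thesis
    by (simp flip: matrix_mul_assoc)
qed

lemma inj_orthogonal_matrix:
  fixes Q :: "real^'n^'n"
  assumes "orthogonal_matrix Q"
  shows "inj ((*v) Q)"
proof (rule inj_on_inverseI)
  show "transpose Q *v (Q *v x) = x" for x
    using assms by (simp add: orthogonal_matrix_def matrix_vector_mul_assoc)
qed

lemma orth_proj_onto_conj:
  fixes Q :: "real^'n^'n"
  assumes Q: "orthogonal_matrix Q" and P: "orth_proj_onto P W"
  shows "orth_proj_onto (Q ** P ** transpose Q) ((*v) Q ` W)"
proof -
  have "transpose Q *v (Q *v x) = x" for x
    using Q by (simp add: orthogonal_matrix_def matrix_vector_mul_assoc)
  hence "range ((*v) (transpose Q)) = UNIV"
    by (rule surjI)
  moreover have "(*v) (Q ** P ** transpose Q) = (*v) Q \<circ> (*v) P \<circ> (*v) (transpose Q)"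
    by (simp add: fun_eq_iff matrix_vector_mul_assoc matrix_mul_assoc del: transpose_matrix_vector)
  ultimately have "range ((*v) (Q ** P ** transpose Q)) = (*v) Q ` range ((*v) P)"
    by (simp only: image_comp[symmetric])
  thus ?thesis
    using P conj_mult[OF Q, of P P]
    by (simp add: orth_proj_onto_def matrix_transpose_mul matrix_mul_assoc)
qed

text \<open>
  Orthonormal bases of \<open>W\<close> and of \<open>W\<^sup>\<bottom>\<close> together form the columns of \<open>Q\<close>; those with index in
  \<open>I\<close> are taken from the basis of \<open>W\<close>.
\<close>

lemma exists_orthogonal_onto:
  fixes W :: "(real^'n) set"
  assumes W: "subspace W" and d: "dim W = card I"
  obtains Q where "orthogonal_matrix Q" "(*v) Q ` coord_subspace I = W"
proof -
  obtain B where B: "B \<subseteq> W" "pairwise orthogonal B" "\<forall>x\<in>B. norm x = 1"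
      "independent B" "card B = dim W" "span B = W"
    by (rule orthonormal_basis_subspace[OF W]) blast
  obtain C where C: "C \<subseteq> W\<^sup>\<bottom>" "pairwise orthogonal C" "\<forall>x\<in>C. norm x = 1"
      "independent C" "card C = dim (W\<^sup>\<bottom>)" "span C = W\<^sup>\<bottom>"
    by (rule orthonormal_basis_subspace[OF subspace_orthogonal_comp[of W]]) blast
  have "dim (W\<^sup>\<bottom>) + dim W = CARD('n)"
    using dim_subspace_orthogonal_to_vectors[OF W subspace_UNIV]
    by (simp add: orthogonal_comp_def)
  hence "card C = card (- I)"
    using C(5) d by (simp add: Compl_eq_Diff_UNIV card_Diff_subset)
  then obtain g where g: "bij_betw g (- I) C"
    using finite_same_card_bij[of "- I" C] independent_bound[OF C(4)] by auto
  obtain f where f: "bij_betw f I B"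
    using finite_same_card_bij[of I B] independent_bound[OF B(4)] B(5) d by auto
  define h where "h i = (if i \<in> I then f i else g i)" for i
  have hI: "h i \<in> B" if "i \<in> I" for i using that f by (auto simp: h_def bij_betw_def)
  have hnI: "h i \<in> C" if "i \<notin> I" for i using that g by (auto simp: h_def bij_betw_def)
  have WC: "orthogonal x y" if "x \<in> B" "y \<in> C" for x y
    using that B(1) C(1) unfolding orthogonal_comp_def by blast
  have n: "norm (h i) = 1" for i using hI[of i] hnI[of i] B(3) C(3) by blast
  have o: "orthogonal (h i) (h j)" if "i \<noteq> j" for i j
  proof -
    consider "i \<in> I" "j \<in> I" | "i \<in> I" "j \<notin> I" | "i \<notin> I" "j \<in> I" | "i \<notin> I" "j \<notin> I" by blast
    thus ?thesis
    proof cases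
      case 1
      hence "h i \<noteq> h j" using f that by (auto simp: h_def bij_betw_def inj_on_def)
      thus ?thesis using B(2) 1 hI by (auto simp: pairwise_def)
    next
      case 4
      hence "h i \<noteq> h j" using g that by (auto simp: h_def bij_betw_def inj_on_def)
      thus ?thesis using C(2) 4 hnI by (auto simp: pairwise_def)
    next
      case 2
      thus ?thesis by (intro WC hI hnI)
    next
      case 3
      hence "orthogonal (h j) (h i)" by (intro WC hI hnI)
      thus ?thesis by (simp only: orthogonal_commute)
    qed
  qed
  define Q :: "real^'n^'n" where "Q = (\<chi> i j. h j $ i)"
  have col: "column i Q = h i" for i by (simp add: column_def Q_def vec_eq_iff)
  have Q: "orthogonal_matrix Q"
    unfolding orthogonal_matrix_orthonormal_columns col using n o by simp
  have lin: "linear ((*v) Q)" by (rule matrix_vector_mul_linear)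
  have "inj ((*v) Q)"
    by (rule inj_orthogonal_matrix[OF Q])
  hence "dim ((*v) Q ` coord_subspace I) = dim W"
    by (simp add: d dim_image_eq[OF lin] dim_coord_subspace inj_on_subset)
  moreover have "(*v) Q ` coord_subspace I \<subseteq> W"
  proof (rule image_subsetI)
    fix x :: "real^'n" assume x: "x \<in> coord_subspace I"
    have "x $ i *\<^sub>R h i \<in> W" for i
      using x hI[of i] B(1) W by (cases "i \<in> I") (auto simp: coord_subspace_def subspace_0 subspace_scale)
    thus "Q *v x \<in> W"
      by (simp add: matrix_mult_sum scalar_mult_eq_scaleR col subspace_sum[OF W])
  qed
  ultimately have "(*v) Q ` coord_subspace I = W"
    by (intro subspace_dim_equal linear_subspace_image[OF lin] subspace_coord_subspace W) simp_all
  with Q that show thesis by blast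
qed

lemma signed_perm_coord_subspace:
  assumes "inj \<pi>" and s: "\<And>i. s i * s i = 1" and "\<And>i. i \<notin> I \<Longrightarrow> \<pi> i \<notin> I"
  shows "(*v) (signed_perm s \<pi>) ` coord_subspace I = coord_subspace I"
proof (rule subspace_dim_equal)
  have lin: "linear ((*v) (signed_perm s \<pi>))" by (rule matrix_vector_mul_linear)
  show "subspace ((*v) (signed_perm s \<pi>) ` coord_subspace I)"
    by (rule linear_subspace_image[OF lin subspace_coord_subspace])
  have "inj ((*v) (signed_perm s \<pi>))"
    by (rule inj_orthogonal_matrix, rule orthogonal_signed_perm) (use assms in auto)
  thus "dim (coord_subspace I) \<le> dim ((*v) (signed_perm s \<pi>) ` coord_subspace I)"
    by (simp add: dim_image_eq[OF lin] inj_on_subset)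
  show "(*v) (signed_perm s \<pi>) ` coord_subspace I \<subseteq> coord_subspace I"
    using assms(3) by (auto simp: coord_subspace_def signed_perm_mult_vector)
qed (rule subspace_coord_subspace)

text \<open>
  If the orthogonal matrix has determinant \<open>-1\<close>, it can be composed with the reflection in one
  coordinate hyperplane: such a reflection preserves every coordinate subspace.
\<close>

lemma exists_rotation_onto:
  fixes W :: "(real^'n) set"
  assumes W: "subspace W" and d: "dim W = card I"
  obtains Q where "rotation_matrix Q" "(*v) Q ` coord_subspace I = W"
proof -
  obtain Q where Q: "orthogonal_matrix Q" "(*v) Q ` coord_subspace I = W"
    using exists_orthogonal_onto[OF assms] .
  show thesis
  proof (cases "det Q = 1")
    case True
    with Q that show thesis by (auto simp: rotation_matrix_def)
  next
    case False
    with det_orthogonal_matrix[OF Q(1)] have dQ: "det Q = -1" by blast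
    fix i0 :: 'n
    define s :: "'n \<Rightarrow> real" where "s = (\<lambda>i. if i = i0 then -1 else 1)"
    let ?F = "signed_perm s id"
    have s: "s i * s i = 1" for i by (simp add: s_def)
    have "orthogonal_matrix (Q ** ?F)"
      by (intro orthogonal_matrix_mul Q(1) orthogonal_signed_perm) (auto simp: s)
    moreover have "det (Q ** ?F) = 1"
      by (simp add: det_mul dQ det_signed_perm_id s_def)
    moreover have "(*v) (Q ** ?F) ` coord_subspace I = (*v) Q ` (*v) ?F ` coord_subspace I"
      by (simp add: image_image matrix_vector_mul_assoc)
    moreover have "(*v) ?F ` coord_subspace I = coord_subspace I"
      by (rule signed_perm_coord_subspace) (auto simp: s)
    ultimately show thesis
      using Q(2) by (intro that[of "Q ** ?F"]) (auto simp: rotation_matrix_def)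
  qed
qed

lemma trace_conj:
  fixes Q :: "real^'n^'n"
  assumes "orthogonal_matrix Q"
  shows "trace (Q ** X ** transpose Q) = trace X"
proof -
  have "trace (Q ** X ** transpose Q) = trace (transpose Q ** Q ** X)"
    by (simp add: trace_mul_sym[of "Q ** X"] matrix_mul_assoc)
  thus ?thesis
    using assms by (simp add: orthogonal_matrix_def)
qed

lemma trace_coord_proj: "trace (coord_proj I) = real (card I)"
  by (simp add: trace_def coord_proj_def sum.If_cases)

text \<open>Conjugation by an orthogonal matrix reduces this to the projection onto a coordinate subspace.\<close>

lemma trace_orth_proj:
  fixes P :: "real^'n^'n"
  assumes P: "orth_proj_onto P W"
  shows "trace P = real (dim W)"
proof -
  have W: "subspace W"
    using P linear_subspace_image[OF matrix_vector_mul_linear subspace_UNIV]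
    by (auto simp: orth_proj_onto_def)
  have "dim W \<le> CARD('n)" using dim_subset_UNIV[of W] by simp
  then obtain J :: "'n set" where J: "card J = dim W"
    by (metis obtain_subset_with_card_n)
  obtain Q where Q: "orthogonal_matrix Q" "(*v) Q ` coord_subspace J = W"
    by (rule exists_orthogonal_onto[OF W J[symmetric]])
  have "P = Q ** coord_proj J ** transpose Q"
    by (rule orth_proj_onto_unique[OF P])
       (use orth_proj_onto_conj[OF Q(1) orth_proj_onto_coord[of J]] Q(2) in simp)
  thus ?thesis by (simp add: trace_conj[OF Q(1)] trace_coord_proj J)
qed


section \<open>Matrices with two prescribed eigenvalues\<close>

lemma matrix_add_rdistrib:
  fixes A B :: "real^'n^'m"
  shows "(A + B) ** C = A ** C + B ** C"
  by (simp add: vec_eq_iff matrix_matrix_mult_def distrib_right sum.distrib)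

lemma matrix_diff_rdistrib:
  fixes A B :: "real^'n^'m"
  shows "(A - B) ** C = A ** C - B ** C"
  by (simp add: vec_eq_iff matrix_matrix_mult_def left_diff_distrib sum_subtractf)

lemma mat_eq_scaleR: "mat c = c *\<^sub>R (mat 1 :: real^'n^'n)"
  by (simp add: vec_eq_iff mat_def)

lemma conj_affine:
  fixes Q :: "real^'n^'n"
  assumes "orthogonal_matrix Q"
  shows "Q ** (mat b + c *\<^sub>R P) ** transpose Q = mat b + c *\<^sub>R (Q ** P ** transpose Q)"
proof -
  have "Q ** (mat b + c *\<^sub>R P) ** transpose Q
      = b *\<^sub>R (Q ** transpose Q) + c *\<^sub>R (Q ** P ** transpose Q)"
    unfolding mat_eq_scaleR[of b]
    by (simp add: matrix_add_ldistrib matrix_add_rdistrib matrix_scalar_ac flip: scalar_matrix_assoc)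
  thus ?thesis
    using assms by (simp add: orthogonal_matrix_def mat_eq_scaleR[of b])
qed

text \<open>
  With \<open>X = b I + (a - b) P\<close> one has \<open>(X - a I)(X - b I) = (a - b)\<^sup>2 (P\<^sup>2 - P)\<close> and
  \<open>tr X = b n + (a - b) tr P\<close>, so each of the conditions on \<open>X\<close> becomes one on \<open>P\<close>.
\<close>

lemma Gr_ab_affine_iff:
  fixes P :: "real^'n^'n"
  assumes ab: "a \<noteq> b" and k: "k \<le> CARD('n)"
  shows "mat b + (a - b) *\<^sub>R P \<in> Gr_ab a b k \<longleftrightarrow>
    transpose P = P \<and> P ** P = P \<and> trace P = real k"
proof -
  let ?X = "mat b + (a - b) *\<^sub>R P"
  have "transpose ?X = ?X \<longleftrightarrow> transpose P = P"
  proof -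
    have "transpose ?X - ?X = (a - b) *\<^sub>R (transpose P - P)"
      by (simp add: vec_eq_iff transpose_def mat_def algebra_simps)
    thus ?thesis using ab by (metis eq_iff_diff_eq_0 scaleR_eq_0_iff)
  qed
  moreover have "(?X - mat a) ** (?X - mat b) = 0 \<longleftrightarrow> P ** P = P"
  proof -
    have 1: "?X - mat a = (a - b) *\<^sub>R (P - mat 1)"
      by (simp add: mat_eq_scaleR[of b] mat_eq_scaleR[of a] algebra_simps)
    have 2: "?X - mat b = (a - b) *\<^sub>R P" by simp
    have "(?X - mat a) ** (?X - mat b) = ((a - b) * (a - b)) *\<^sub>R (P ** P - P)"
      unfolding 1 2
      by (simp add: matrix_diff_rdistrib matrix_scalar_ac flip: scalar_matrix_assoc)
    thus ?thesis using ab by simp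
  qed
  moreover have "trace ?X = a * real k + b * real (CARD('n) - k) \<longleftrightarrow> trace P = real k"
  proof -
    have "trace ?X = b * real CARD('n) + (a - b) * trace P"
      by (simp add: trace_def mat_def sum.distrib sum_distrib_left)
    hence "trace ?X - (a * real k + b * real (CARD('n) - k)) = (a - b) * (trace P - real k)"
      using k by (simp add: of_nat_diff algebra_simps)
    thus ?thesis using ab by (metis eq_iff_diff_eq_0 mult_eq_0_iff)
  qed
  ultimately show ?thesis
    by (simp add: Gr_ab_def symmetric_matrices_def)
qed

definition initial_indices :: "nat \<Rightarrow> ('n::{finite,linorder}) set" where
  "initial_indices k = {i. card {l. l < i} < k}"

text \<open>The rank function \<open>i \<mapsto> card {l. l < i}\<close> is a bijection from the index type onto \<open>{..<n}\<close>.\<close>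

lemma card_initial_indices:
  assumes "k \<le> CARD('n::{finite,linorder})"
  shows "card (initial_indices k :: ('n::{finite,linorder}) set) = k"
proof -
  let ?r = "\<lambda>i::'n. card {l. l < i}"
  have mono: "?r i < ?r j" if "i < j" for i j
    by (rule psubset_card_mono) (use that in auto)
  hence inj: "inj ?r"
    by (intro linorder_injI less_imp_neq mono)
  have "?r i < CARD('n)" for i
    by (rule psubset_card_mono) auto
  hence "range ?r \<subseteq> {..<CARD('n)}" by blast
  moreover have "card (range ?r) = card {..<CARD('n)}"
    by (simp only: card_image[OF inj] card_lessThan)
  ultimately have range: "range ?r = {..<CARD('n)}"
    by (rule card_subset_eq[OF finite_lessThan])
  have "?r ` initial_indices k = {..<k}"
  proof (intro equalityI subsetI)
    fix m assume m: "m \<in> {..<k}"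
    hence "m \<in> range ?r" using assms by (simp add: range)
    then obtain i where "m = ?r i" by blast
    with m show "m \<in> ?r ` initial_indices k" by (auto simp: initial_indices_def)
  qed (auto simp: initial_indices_def)
  moreover have "card (?r ` initial_indices k) = card (initial_indices k :: 'n set)"
    by (rule card_image[OF inj_on_subset[OF inj subset_UNIV]])
  ultimately show ?thesis
    by (simp only: card_lessThan)
qed

lemma block_diag_eq_affine:
  "block_diag a b k = mat b + (a - b) *\<^sub>R coord_proj (initial_indices k)"
  by (auto simp: block_diag_def initial_indices_def coord_proj_def mat_def vec_eq_iff)

text \<open>
  The nontrivial inclusion is the spectral theorem for matrices with two prescribed eigenvalues,
  read off from projections: \<open>P = (X - b I) / (a - b)\<close> is an orthogonal projection, its trace \<open>k\<close> is
  the dimension of its range, and a rotation that moves the first coordinate subspace to this range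
  conjugates the corresponding projections into each other.
\<close>

theorem Gr_ab_eq_orbit:
  assumes ab: "a \<noteq> b" and k: "k \<le> CARD('n::{finite,linorder})"
  shows "(Gr_ab a b k :: (real^('n::{finite,linorder})^('n::{finite,linorder})) set) =
    {Q ** block_diag a b k ** transpose Q | Q. rotation_matrix Q}"
proof (intro equalityI subsetI)
  fix X :: "((real, 'n) vec, 'n) vec" assume X: "X \<in> Gr_ab a b k"
  define P where "P = (1 / (a - b)) *\<^sub>R (X - mat b)"
  have XP: "X = mat b + (a - b) *\<^sub>R P" using ab by (simp add: P_def)
  hence P: "transpose P = P" "P ** P = P" "trace P = real k"
    using X Gr_ab_affine_iff[OF ab k, of P] by simp_all
  define W where "W = range ((*v) P)"
  have PW: "orth_proj_onto P W" using P by (simp add: orth_proj_onto_def W_def)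
  have "subspace W"
    unfolding W_def by (rule linear_subspace_image[OF matrix_vector_mul_linear subspace_UNIV])
  moreover have "dim W = card (initial_indices k :: 'n set)"
    unfolding card_initial_indices[OF k] using trace_orth_proj[OF PW] P(3) by simp
  ultimately obtain Q where Q: "rotation_matrix Q" "(*v) Q ` coord_subspace (initial_indices k) = W"
    by (rule exists_rotation_onto)
  have oQ: "orthogonal_matrix Q" using Q(1) by (simp add: rotation_matrix_def)
  have "P = Q ** coord_proj (initial_indices k) ** transpose Q"
    by (rule orth_proj_onto_unique[OF PW])
       (use orth_proj_onto_conj[OF oQ orth_proj_onto_coord[of "initial_indices k"]] Q(2) in simp)
  hence "X = Q ** block_diag a b k ** transpose Q"
    by (simp add: XP block_diag_eq_affine conj_affine[OF oQ])
  with Q(1) show "X \<in> {Q ** block_diag a b k ** transpose Q | Q. rotation_matrix Q}"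
      by (intro CollectI exI conjI)
next
  fix X :: "((real, 'n) vec, 'n) vec" assume "X \<in> {Q ** block_diag a b k ** transpose Q | Q. rotation_matrix Q}"
  then obtain Q :: "((real, 'n) vec, 'n) vec" where Q: "rotation_matrix Q" and X: "X = Q ** block_diag a b k ** transpose Q"
    by blast
  have oQ: "orthogonal_matrix Q" using Q(1) by (simp add: rotation_matrix_def)
  let ?P = "coord_proj (initial_indices k) :: ((real, 'n) vec, 'n) vec"
  have "orth_proj_onto (Q ** ?P ** transpose Q) ((*v) Q ` coord_subspace (initial_indices k))"
    by (rule orth_proj_onto_conj[OF oQ orth_proj_onto_coord])
  moreover have "trace (Q ** ?P ** transpose Q) = real k"
    by (simp add: trace_conj[OF oQ] trace_coord_proj card_initial_indices[OF k])
  ultimately show "X \<in> Gr_ab a b k"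
    unfolding X block_diag_eq_affine conj_affine[OF oQ] Gr_ab_affine_iff[OF ab k]
    by (simp add: orth_proj_onto_def)
qed

section \<open>Matrices fixed by the stabilizer of a coordinate subspace\<close>

text \<open>
  Changing the signs of two coordinates \<open>i\<close> and \<open>l\<close> is a rotation that preserves every coordinate
  subspace; if \<open>j\<close> is a third index, invariance gives \<open>X\<^sub>i\<^sub>j = - X\<^sub>i\<^sub>j\<close>. This is where
  \<open>n \<ge> 3\<close> is essential. Exchanging two coordinates on the same side of \<open>I\<close>, with a sign if the
  determinant asks for it, then identifies the corresponding diagonal entries.
\<close>

lemma block_scalar_if_stabilizer_invariant:
  fixes X :: "real^'n^'n"
  assumes n: "3 \<le> CARD('n)"
    and inv: "\<And>Q. rotation_matrix Q \<Longrightarrow> (*v) Q ` coord_subspace I = coord_subspace I \<Longrightarrow>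
      Q ** X ** transpose Q = X"
  obtains a b where "X = mat b + (a - b) *\<^sub>R coord_proj I"
proof -
  have off: "X $ i $ j = 0" if "i \<noteq> j" for i j
  proof -
    have "card {i, j} < CARD('n)"
      using that n by simp
    hence "{i, j} \<noteq> UNIV"
      by (metis less_irrefl)
    then obtain l where l: "l \<noteq> i" "l \<noteq> j" by blast
    define s :: "'n \<Rightarrow> real" where "s m = (if m \<in> {i, l} then -1 else 1)" for m
    have s: "s m * s m = 1" for m by (simp add: s_def)
    have "prod s UNIV = prod s {i, l}"
      by (rule prod.mono_neutral_right) (auto simp: s_def)
    also have "\<dots> = 1" using l by (simp add: s_def)
    finally have "prod s UNIV = 1" .
    hence "rotation_matrix (signed_perm s id)"
      by (simp add: rotation_matrix_def det_signed_perm_id orthogonal_signed_perm s)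
    moreover have "(*v) (signed_perm s id) ` coord_subspace I = coord_subspace I"
      by (rule signed_perm_coord_subspace) (auto simp: s)
    ultimately have fixed: "signed_perm s id ** X ** transpose (signed_perm s id) = X"
      by (rule inv)
    have "X $ i $ j = s i * s j * X $ i $ j"
      using signed_perm_conj[of s id X i j] unfolding fixed by simp
    also have "\<dots> = - X $ i $ j" using l that by (simp add: s_def)
    finally show ?thesis by simp
  qed
  have diag: "X $ i $ i = X $ j $ j" if "i \<in> I \<longleftrightarrow> j \<in> I" for i j
  proof -
    define \<pi> where "\<pi> = Transposition.transpose i j"
    have inj: "inj \<pi>" by (simp add: \<pi>_def)
    obtain s where s: "\<forall>m. s m * s m = 1" "rotation_matrix (signed_perm s \<pi>)"
      by (rule exists_rotation_signed_perm[OF inj])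
    have "\<pi> m \<notin> I" if "m \<notin> I" for m
      using that \<open>i \<in> I \<longleftrightarrow> j \<in> I\<close> unfolding \<pi>_def Transposition.transpose_def
      by presburger
    hence "(*v) (signed_perm s \<pi>) ` coord_subspace I = coord_subspace I"
      by (rule signed_perm_coord_subspace[OF inj s(1)[rule_format]])
    with s(2) have fixed: "signed_perm s \<pi> ** X ** transpose (signed_perm s \<pi>) = X"
      by (rule inv)
    have "\<pi> j = i" by (simp add: \<pi>_def)
    have "X $ j $ j = s j * s j * X $ i $ i"
      using signed_perm_conj[of s \<pi> X j j] unfolding fixed \<open>\<pi> j = i\<close> .
    thus ?thesis by (simp add: s(1)[rule_format])
  qed
  \<comment> \<open>If \<open>I\<close> or its complement is empty, then the entry selected for it is arbitrary, and its
    value cancels in the equation.\<close>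
  define p q where "p = (SOME i. i \<in> I)" and "q = (SOME i. i \<notin> I)"
  define a b where "a = X $ p $ p" and "b = X $ q $ q"
  have a: "X $ i $ i = a" if "i \<in> I" for i
    unfolding a_def b_def by (rule diag) (use that someI[of "\<lambda>i. i \<in> I"] in \<open>simp add: p_def q_def\<close>)
  have b: "X $ i $ i = b" if "i \<notin> I" for i
    unfolding a_def b_def by (rule diag) (use that someI[of "\<lambda>i. i \<notin> I"] in \<open>simp add: p_def q_def\<close>)
  have "X = mat b + (a - b) *\<^sub>R coord_proj I"
    using off a b by (auto simp: vec_eq_iff mat_def coord_proj_def)
  thus thesis by (rule that)
qed

text \<open>
  A trace-free symmetric \<open>2 \<times> 2\<close> matrix with diagonal entries \<open>p\<close>, \<open>- p\<close> and off-diagonal entry \<open>q\<close>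
  squares to \<open>(p\<^sup>2 + q\<^sup>2) I\<close>. Adding \<open>t I\<close>, half the trace, gives the roots \<open>t \<plusminus> r\<close> with
  \<open>r\<^sup>2 = p\<^sup>2 + q\<^sup>2\<close>, and they coincide only if \<open>p = q = 0\<close>.
\<close>

lemma symmetric_2x2_in_Gr_ab:
  fixes X :: "real^'n^'n"
  assumes n: "CARD('n) = 2" and X: "transpose X = X"
  obtains a b where "X \<in> Gr_ab a b 1" "a = b \<longrightarrow> X = mat a"
proof -
  obtain i j :: 'n where ij: "UNIV = {i, j}" "i \<noteq> j"
    using n by (auto simp: card_2_iff)
  have sum: "sum f UNIV = f i + f j" for f :: "'n \<Rightarrow> real"
    unfolding ij(1) using ij(2) by simp
  have all: "(\<forall>m. R m) \<longleftrightarrow> R i \<and> R j" for R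
  proof -
    have "(\<forall>m. R m) \<longleftrightarrow> (\<forall>m\<in>UNIV. R m)" by simp
    thus ?thesis unfolding ij(1) by simp
  qed
  have sym: "X $ j $ i = X $ i $ j" 
    using arg_cong[OF X, of "\<lambda>A. A $ i $ j"] by (simp add: transpose_def)
  define t p q where "t = (X $ i $ i + X $ j $ j) / 2" "p = (X $ i $ i - X $ j $ j) / 2" "q = X $ i $ j"
  define r where "r = sqrt (p\<^sup>2 + q\<^sup>2)"
  have Xe: "X $ i $ i = t + p" "X $ j $ j = t - p" "X $ i $ j = q" "X $ j $ i = q"
    by (auto simp: t_p_q_def sym field_simps)
  have r: "r * r = p * p + q * q"
    by (simp add: r_def flip: power2_eq_square)
  have "(X - mat (t + r)) ** (X - mat (t - r)) = 0"
    using ij(2) r by (simp add: vec_eq_iff all matrix_matrix_mult_def sum mat_def Xe algebra_simps)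
  moreover have "trace X = (t + r) * real 1 + (t - r) * real (CARD('n) - 1)"
    by (simp add: trace_def sum Xe n)
  ultimately have "X \<in> Gr_ab (t + r) (t - r) 1"
    using X by (simp add: Gr_ab_def symmetric_matrices_def)
  moreover have "t + r = t - r \<longrightarrow> X = mat (t + r)"
  proof
    assume "t + r = t - r"
    hence r0: "r = 0" by simp
    hence "p * p + q * q = 0" using r by simp
    hence "p = 0" "q = 0" using sum_squares_eq_zero_iff[of p q] by blast+
    thus "X = mat (t + r)" using ij(2) r0 by (simp add: vec_eq_iff all mat_def Xe)
  qed
  ultimately show thesis by (rule that)
qed

section \<open>Equivariant embeddings\<close>

theorem corollary4p4:
  fixes k :: nat
    and \<epsilon> :: "(real^('n::{finite,linorder})) set \<Rightarrow> real^('n::{finite,linorder})^('n::{finite,linorder})"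
  assumes "0 < k" and "k < CARD('n)"
    and "\<epsilon> ` Gr k \<subseteq> symmetric_matrices"
    and "smooth_embedding_Gr k \<epsilon>"
    and "SO_equivariant_Gr k \<epsilon>"
  shows "\<exists>a b :: real. a \<noteq> b \<and>
    \<epsilon> ` Gr k = Gr_ab a b k \<and>
    (Gr_ab a b k :: (real^('n::{finite,linorder})^('n::{finite,linorder})) set) =
      {Q ** block_diag a b k ** transpose Q | Q. rotation_matrix Q}"
proof -
  have kn: "k \<le> CARD('n)" using assms(2) by simp
  let ?I = "initial_indices k :: 'n set"
  define E where "E = coord_subspace ?I"
  define X where "X = \<epsilon> E"
  have cI: "card ?I = k" by (rule card_initial_indices[OF kn])
  have E: "E \<in> Gr k" unfolding E_def using coord_subspace_in_Gr[of ?I] cI by simp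
  have equi: "\<epsilon> ((*v) Q ` E) = Q ** X ** transpose Q" if "rotation_matrix Q" for Q
    using assms(5) that E by (simp add: SO_equivariant_Gr_def X_def)
  have trans: "\<exists>Q. rotation_matrix Q \<and> (*v) Q ` E = W" if "W \<in> Gr k" for W
  proof -
    have "subspace W" "dim W = card ?I" using that cI by (simp_all add: Gr_def)
    then obtain Q where "rotation_matrix Q" "(*v) Q ` coord_subspace ?I = W"
      by (rule exists_rotation_onto)
    thus ?thesis by (auto simp: E_def)
  qed
  have orbit: "\<epsilon> ` Gr k = {Q ** X ** transpose Q | Q. rotation_matrix Q}"
  proof (intro equalityI subsetI)
    fix Y assume "Y \<in> \<epsilon> ` Gr k"
    then obtain W where "Y = \<epsilon> W" "W \<in> Gr k" by blast
    then obtain Q where Q: "rotation_matrix Q" "(*v) Q ` E = W" using trans[of W] by blast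
    have "Y = Q ** X ** transpose Q"
      unfolding \<open>Y = \<epsilon> W\<close> Q(2)[symmetric] by (rule equi[OF Q(1)])
    with Q(1) show "Y \<in> {Q ** X ** transpose Q | Q. rotation_matrix Q}"
      by (intro CollectI exI conjI)
  next
    fix Y assume "Y \<in> {Q ** X ** transpose Q | Q. rotation_matrix Q}"
    then obtain Q where Q: "rotation_matrix Q" "Y = Q ** X ** transpose Q"
      by blast
    have "(*v) Q ` E \<in> Gr k"
    proof -
      have lin: "linear ((*v) Q)" by (rule matrix_vector_mul_linear)
      have "inj ((*v) Q)"
        using Q(1) by (simp add: inj_orthogonal_matrix rotation_matrix_def)
      hence "dim ((*v) Q ` E) = dim E"
        by (rule dim_image_eq[OF lin inj_on_subset[OF _ subset_UNIV]])
      moreover have "subspace E" "dim E = k"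
        using E by (simp_all only: Gr_def mem_Collect_eq)
      ultimately show ?thesis
        unfolding Gr_def
        by (intro CollectI conjI linear_subspace_image[OF lin]) (simp_all only:)
    qed
    hence "\<epsilon> ((*v) Q ` E) \<in> \<epsilon> ` Gr k" by (rule imageI)
    thus "Y \<in> \<epsilon> ` Gr k" by (simp only: equi[OF Q(1)] Q(2))
  qed
  have inj: "inj_on \<epsilon> (Gr k)"
  proof -
    have "embedding_map (Gr_topology k) euclidean \<epsilon>"
      using assms(4) unfolding smooth_embedding_Gr_def by (elim conjE)
    thus ?thesis
      unfolding embedding_map_def topspace_Gr_topology[symmetric]
      by (rule homeomorphic_imp_injective_map)
  qed
  have nonscalar: "X \<noteq> mat c" for c
  proof
    assume Xc: "X = mat c"
    \<comment> \<open>Exchanging an index of \<open>E\<close> for another one yields a second \<open>k\<close>-dimensional subspace,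
      on which \<open>\<epsilon>\<close> takes the same value.\<close>
    have "?I \<noteq> {}" "?I \<noteq> UNIV" using cI assms(1,2) by auto
    then obtain i j where ij: "i \<in> ?I" "j \<notin> ?I" by blast
    define J where "J = insert j (?I - {i})"
    have "card J = k" using ij cI assms(1) by (simp add: J_def)
    hence J: "coord_subspace J \<in> Gr k" using coord_subspace_in_Gr[of J] by simp
    then obtain Q where Q: "rotation_matrix Q" "(*v) Q ` E = coord_subspace J"
      using trans[OF J] by blast
    \<comment> \<open>The vanishing summand brings \<open>mat c\<close> into the affine form of \<open>conj_affine\<close>.\<close>
    have "\<epsilon> (coord_subspace J) = Q ** (mat c + 0 *\<^sub>R 0) ** transpose Q"
      using equi[OF Q(1)] Q(2) Xc by simp
    also have "\<dots> = \<epsilon> E"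
      using Q(1) Xc by (subst conj_affine) (simp_all add: rotation_matrix_def X_def)
    finally have "coord_subspace J = coord_subspace ?I"
      using inj J E by (simp add: inj_on_def E_def)
    moreover have "axis j 1 \<in> coord_subspace J" "axis j 1 \<notin> coord_subspace ?I"
      using ij by (auto simp: coord_subspace_def J_def axis_def)
    ultimately show False by simp
  qed
  obtain a b where ab: "a \<noteq> b" and X: "X \<in> Gr_ab a b k"
  proof (cases "CARD('n) = 2")
    case True
    have "transpose X = X" using assms(3) E by (auto simp: X_def symmetric_matrices_def)
    then obtain a b where "X \<in> Gr_ab a b 1" "a = b \<longrightarrow> X = mat a"
      by (rule symmetric_2x2_in_Gr_ab[OF True])
    moreover have "k = 1" using True assms(1,2) by simp
    ultimately show thesis by (intro that[of a b]) (use nonscalar[of a] in auto)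
  next
    case False
    have "3 \<le> CARD('n)" using False assms(1,2) by simp
    moreover have "Q ** X ** transpose Q = X"
      if "rotation_matrix Q" "(*v) Q ` coord_subspace ?I = coord_subspace ?I" for Q
      using equi[OF that(1)] that(2) by (simp add: E_def X_def)
    ultimately obtain a b where X: "X = mat b + (a - b) *\<^sub>R coord_proj ?I"
      by (rule block_scalar_if_stabilizer_invariant)
    have ab: "a \<noteq> b" using nonscalar[of b] X by auto
    moreover have "X \<in> Gr_ab a b k"
      unfolding X Gr_ab_affine_iff[OF ab kn]
      using orth_proj_onto_coord[of ?I] cI by (simp add: orth_proj_onto_def trace_coord_proj)
    ultimately show thesis by (rule that)
  qed
  let ?D = "block_diag a b k :: ((real, 'n) vec, 'n) vec"
  \<comment> \<open>\<open>X\<close> lies in the orbit of \<open>block_diag a b k\<close>, so the two orbits coincide.\<close>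
  obtain R where R: "rotation_matrix R" "X = R ** ?D ** transpose R"
    using X unfolding Gr_ab_eq_orbit[OF ab kn] by blast
  have "\<epsilon> ` Gr k = {Q ** ?D ** transpose Q | Q. rotation_matrix Q}"
    unfolding orbit
  proof (intro equalityI subsetI)
    fix Y assume "Y \<in> {Q ** X ** transpose Q | Q. rotation_matrix Q}"
    then obtain Q where Q: "rotation_matrix Q" "Y = Q ** X ** transpose Q"
      by blast
    have "Y = (Q ** R) ** ?D ** transpose (Q ** R)"
      by (simp add: Q(2) R(2) matrix_transpose_mul matrix_mul_assoc)
    moreover have "rotation_matrix (Q ** R)"
      using Q(1) R(1) by (simp add: rotation_matrix_def orthogonal_matrix_mul det_mul)
    ultimately show "Y \<in> {Q ** ?D ** transpose Q | Q. rotation_matrix Q}"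
      by (intro CollectI exI conjI)
  next
    fix Y assume "Y \<in> {Q ** ?D ** transpose Q | Q. rotation_matrix Q}"
    then obtain Q where Q: "rotation_matrix Q" "Y = Q ** ?D ** transpose Q"
      by blast
    have D: "?D = transpose R ** X ** R"
    proof -
      have "transpose R ** X ** R = (transpose R ** R) ** ?D ** (transpose R ** R)"
        by (simp add: R(2) matrix_mul_assoc)
      thus ?thesis using R(1) by (simp add: rotation_matrix_def orthogonal_matrix_def)
    qed
    have "Y = (Q ** transpose R) ** X ** transpose (Q ** transpose R)"
      by (simp add: Q(2) D matrix_transpose_mul matrix_mul_assoc)
    moreover have "rotation_matrix (Q ** transpose R)"
      using Q(1) R(1) by (simp add: rotation_matrix_def orthogonal_matrix_mul det_mul orthogonal_matrix_transpose)
    ultimately show "Y \<in> {Q ** X ** transpose Q | Q. rotation_matrix Q}"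
      by (intro CollectI exI conjI)
  qed
  hence "\<epsilon> ` Gr k = Gr_ab a b k"
    by (simp only: Gr_ab_eq_orbit[OF ab kn])
  with ab Gr_ab_eq_orbit[OF ab kn] show ?thesis
    by (intro exI conjI)
qed

end
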